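(* Let $p$ be a prime and $d\ge 1$. Let $\phi:\mathbb{F}_p((t))\to \mathrm{Aut}(\mathbb{F}_p((t))^d)$ be a continuous group homomorphism satisfying $$\phi(tf)=\tau\circ\phi(f)\circ\tau^{-1}\quad\text{for all } f\in\mathbb{F}_p((t)),$$ where $\tau:\mathbb{F}_p((t))^d\to\mathbb{F}_p((t))^d$, $(f_1,\dots,f_d)\mapsto(tf_1,\dots,tf_d)$. Then there is $\xi\in\mathbb{F}_p((t))^d\setminus\{0\}$ such that $\phi(f)(\xi)=\xi$ for every $f\in\mathbb{F}_p((t))$.
   Context: $\mathbb{F}_p((t))$ denotes the additive group of formal Laurent series over $\mathbb{F}_p$, with its usual locally compact totally disconnected topology, in which $\mathbb{F}_p[[t]]$ is a compact open subgroup; $\mathbb{F}_p((t))^d$ carries the product topology. $\mathrm{Aut}(\mathbb{F}_p((t))^d)$ is the group of automorphisms of the topological group $(\mathbb{F}_p((t))^d,+)$ (not necessarily $\mathbb{F}_p((t))$-linear), equipped with the Braconnier topology: the group topology having as a basis of identity neighbourhoods the sets $\{\alpha : \alpha(x)-x\in U \text{ and } \alpha^{-1}(x)-x\in U \text{ for all } x\in K\}$ with $K$ compact and $U$ an identity neighbourhood. *)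

theory Defs
  imports "HOL-Analysis.Analysis" "HOL-Computational_Algebra.Formal_Laurent_Series"
    "HOL-Library.Function_Algebras"
begin

text \<open>F_p((t)) is rendered as the type 'a fls of formal Laurent series over a field 'a with
  CARD('a) = p prime (such a field is F_p). Its topology is the library's t-adic metric
  topology. F_p((t))^d is 'n \<Rightarrow> 'a fls for a finite index type 'n (d = CARD('n) \<ge> 1),
  with the product topology (library instance for function spaces).\<close>

definition top_group_aut :: "(('n::finite \<Rightarrow> 'a::field fls) \<Rightarrow> ('n \<Rightarrow> 'a fls)) set" where
  "top_group_aut = {\<alpha>. bij \<alpha> \<and> (\<forall>x y. \<alpha> (x + y) = \<alpha> x + \<alpha> y)
       \<and> continuous_on UNIV \<alpha> \<and> continuous_on UNIV (inv \<alpha>)}"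

definition braconnier_nbhd ::
  "('n::finite \<Rightarrow> 'a::field fls) set \<Rightarrow> ('n \<Rightarrow> 'a fls) set \<Rightarrow> (('n \<Rightarrow> 'a fls) \<Rightarrow> ('n \<Rightarrow> 'a fls)) set" where
  "braconnier_nbhd K U = {\<alpha> \<in> top_group_aut. \<forall>x\<in>K. \<alpha> x - x \<in> U \<and> inv \<alpha> x - x \<in> U}"

definition identity_nbhd :: "('n::finite \<Rightarrow> 'a::field fls) set \<Rightarrow> bool" where
  "identity_nbhd U \<longleftrightarrow> (\<exists>W. open W \<and> 0 \<in> W \<and> W \<subseteq> U)"

definition braconnier_open :: "(('n::finite \<Rightarrow> 'a::field fls) \<Rightarrow> ('n \<Rightarrow> 'a fls)) set \<Rightarrow> bool" where
  "braconnier_open S \<longleftrightarrow> S \<subseteq> top_group_aut \<and>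
     (\<forall>\<alpha>\<in>S. \<exists>K U. compact K \<and> identity_nbhd U \<and>
        {\<beta> \<in> top_group_aut. inv \<alpha> \<circ> \<beta> \<in> braconnier_nbhd K U} \<subseteq> S)"

definition braconnier_continuous :: "('a::field fls \<Rightarrow> (('n::finite \<Rightarrow> 'a fls) \<Rightarrow> ('n \<Rightarrow> 'a fls))) \<Rightarrow> bool" where
  "braconnier_continuous \<phi> \<longleftrightarrow> (\<forall>S. braconnier_open S \<longrightarrow> open {f. \<phi> f \<in> S})"

end

theory Submission
  imports Defs
begin

text \<open>
  Write \<open>L\<close> for the lattice \<open>F_p[[t]]^d\<close>. By continuity of \<open>\<phi>\<close>, after precomposing it with
  multiplication by a power of \<open>t\<close>, every \<open>f\<close> in \<open>F_p[[t]]\<close> maps \<open>L\<close> into itself. Let \<open>I\<close> be the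
  set of operators \<open>\<phi>(f) - 1\<close> with \<open>f\<close> in \<open>F_p[[t]]\<close>; they commute and their \<open>p\<close>-th powers vanish.
  Each layer \<open>I\<^sup>m L\<close> (an additive span) is invariant under \<open>\<tau>\<close>. If \<open>I\<^sup>m L = 0\<close> for some \<open>m\<close>, then,
  for the least such \<open>m\<close>, all \<open>f\<close> in \<open>F_p[[t]]\<close> act trivially on the nonzero \<open>\<tau>\<close>-invariant
  group \<open>I\<^sup>m\<^sup>-\<^sup>1 L\<close>, and conjugating by powers of \<open>\<tau>\<close> shows that all of \<open>F_p((t))\<close> does.

  To see that the layers reach \<open>0\<close>: the sets of leading coefficients occurring in the layers
  decrease in a finite set, so two consecutive layers \<open>I\<^sup>k\<^sup>+\<^sup>1 L\<close> and \<open>I\<^sup>k\<^sup>+\<^sup>2 L\<close> agree near zero up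
  to closure. Hence \<open>I\<^sup>k\<^sup>+\<^sup>1 L\<close> is generated, modulo the closure of \<open>I\<^sup>k\<^sup>+\<^sup>2 L\<close>, by \<open>F I\<^sup>k L\<close> for a finite
  subset \<open>F\<close> of \<open>I\<close>, and by Nakayama's argument it lies in the closure of \<open>F I\<^sup>k L\<close>. Thus
  \<open>I\<^sup>k\<^sup>+\<^sup>r L\<close> lies in the closure of \<open>F\<^sup>r I\<^sup>k L\<close>, which is \<open>0\<close> as soon as \<open>r > p |F|\<close>.
\<close>

section \<open>Commuting nilpotent operators on an abelian group\<close>

definition add_subgroup :: "'v::ab_group_add set \<Rightarrow> bool" where
  "add_subgroup X \<longleftrightarrow> 0 \<in> X \<and> (\<forall>x\<in>X. \<forall>y\<in>X. x - y \<in> X)"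

lemma add_subgroupD:
  assumes "add_subgroup X"
  shows "0 \<in> X" "x \<in> X \<Longrightarrow> y \<in> X \<Longrightarrow> x - y \<in> X" "x \<in> X \<Longrightarrow> - x \<in> X"
    "x \<in> X \<Longrightarrow> y \<in> X \<Longrightarrow> x + y \<in> X"
proof -
  show 0: "0 \<in> X" and 1: "\<And>x y. x \<in> X \<Longrightarrow> y \<in> X \<Longrightarrow> x - y \<in> X"
    using assms by (auto simp: add_subgroup_def)
  show 2: "- x \<in> X" if "x \<in> X" for x
    using 1[OF 0 that] by simp
  show "x + y \<in> X" if "x \<in> X" "y \<in> X"
    using 1[OF that(1) 2[OF that(2)]] by simp
qed

inductive_set add_span :: "'v::ab_group_add set \<Rightarrow> 'v set" for A where
  zero: "0 \<in> add_span A"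
| base: "a \<in> A \<Longrightarrow> a \<in> add_span A"
| diff: "x \<in> add_span A \<Longrightarrow> y \<in> add_span A \<Longrightarrow> x - y \<in> add_span A"

lemma add_subgroup_add_span: "add_subgroup (add_span A)"
  by (auto simp: add_subgroup_def intro: add_span.intros)

lemma add_span_least:
  assumes "add_subgroup Z" "A \<subseteq> Z"
  shows "add_span A \<subseteq> Z"
proof
  fix x assume "x \<in> add_span A"
  then show "x \<in> Z"
    by induction (use assms add_subgroupD[OF assms(1)] in auto)
qed

lemma add_span_mono: "A \<subseteq> B \<Longrightarrow> add_span A \<subseteq> add_span B"
  by (rule add_span_least[OF add_subgroup_add_span]) (auto intro: add_span.base)

lemma add_span_finite_support:
  assumes "x \<in> add_span A"
  obtains B where "finite B" "B \<subseteq> A" "x \<in> add_span B"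
  using assms
proof (induction arbitrary: thesis)
  case zero
  show ?case using zero[of "{}"] by (auto intro: add_span.zero)
next
  case (base a)
  show ?case using base(2)[of "{a}"] base(1) by (auto intro: add_span.base)
next
  case (diff x y)
  obtain B where B: "finite B" "B \<subseteq> A" "x \<in> add_span B" using diff.IH(1) by blast
  obtain C where C: "finite C" "C \<subseteq> A" "y \<in> add_span C" using diff.IH(2) by blast
  have "x \<in> add_span (B \<union> C)" "y \<in> add_span (B \<union> C)"
    using B C add_span_mono[of B "B \<union> C"] add_span_mono[of C "B \<union> C"] by auto
  then show ?case using diff.prems[of "B \<union> C"] B C by (auto intro: add_span.diff)
qed

text \<open>The sumset \<open>Q + T\<close>. With \<open>T\<close> running through small subgroups
  it stands for the closure of \<open>Q\<close>, so that closures are handled algebraically.\<close>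

definition near :: "'v::ab_group_add set \<Rightarrow> 'v set \<Rightarrow> 'v set" where
  "near Q T = {x. \<exists>q\<in>Q. x - q \<in> T}"

lemma add_subgroup_near:
  assumes "add_subgroup Q" "add_subgroup T"
  shows "add_subgroup (near Q T)"
  unfolding add_subgroup_def
proof (intro conjI ballI)
  show "0 \<in> near Q T"
    using add_subgroupD(1)[OF assms(1)] add_subgroupD(1)[OF assms(2)]
    by (force simp: near_def)
  fix x y assume "x \<in> near Q T" "y \<in> near Q T"
  then obtain q r where *: "q \<in> Q" "r \<in> Q" "x - q \<in> T" "y - r \<in> T" by (auto simp: near_def)
  have "(x - y) - (q - r) = (x - q) - (y - r)" by simp
  then have "(x - y) - (q - r) \<in> T" using * add_subgroupD(2)[OF assms(2)] by metis
  then show "x - y \<in> near Q T" using * add_subgroupD(2)[OF assms(1)] by (auto simp: near_def)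
qed

lemma subset_nearI: "add_subgroup T \<Longrightarrow> Q \<subseteq> near Q T"
  using add_subgroupD(1)[of T] by (force simp: near_def)

lemma subset_nearI2: "add_subgroup Q \<Longrightarrow> T \<subseteq> near Q T"
  using add_subgroupD(1)[of Q] by (force simp: near_def)

lemma near_least:
  assumes "add_subgroup Z" "Q \<subseteq> Z" "T \<subseteq> Z"
  shows "near Q T \<subseteq> Z"
proof
  fix x assume "x \<in> near Q T"
  then obtain q where "q \<in> Z" "x - q \<in> Z" using assms by (auto simp: near_def)
  then show "x \<in> Z" using add_subgroupD(4)[OF assms(1), of q "x - q"] by simp
qed

lemma near_mono: "Q \<subseteq> Q' \<Longrightarrow> near Q T \<subseteq> near Q' T"
  by (auto simp: near_def)

text \<open>The product of an ideal with a module, formed from a mere set of operators. Iterating it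
  yields the layers \<open>I\<^sup>m L\<close>.\<close>

definition aug :: "('v::ab_group_add \<Rightarrow> 'v) set \<Rightarrow> 'v set \<Rightarrow> 'v set" where
  "aug F X = add_span {y x |y x. y \<in> F \<and> x \<in> X}"

lemma add_subgroup_aug: "add_subgroup (aug F X)"
  by (simp add: aug_def add_subgroup_add_span)

lemma augI: "y \<in> F \<Longrightarrow> x \<in> X \<Longrightarrow> y x \<in> aug F X"
  unfolding aug_def by (rule add_span.base) auto

lemma aug_least:
  assumes "add_subgroup Z" "\<And>y x. y \<in> F \<Longrightarrow> x \<in> X \<Longrightarrow> y x \<in> Z"
  shows "aug F X \<subseteq> Z"
  unfolding aug_def by (rule add_span_least[OF assms(1)]) (use assms(2) in auto)

lemma aug_mono: "F \<subseteq> F' \<Longrightarrow> X \<subseteq> X' \<Longrightarrow> aug F X \<subseteq> aug F' X'"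
  by (rule aug_least[OF add_subgroup_aug]) (auto intro: augI)

text \<open>An element of the span involves finitely many generators, hence finitely many
  operators.\<close>

lemma aug_finite_support:
  assumes "x \<in> aug F X"
  obtains G where "finite G" "G \<subseteq> F" "x \<in> aug G X"
proof -
  obtain B where B: "finite B" "B \<subseteq> {y x |y x. y \<in> F \<and> x \<in> X}" "x \<in> add_span B"
    using add_span_finite_support[OF assms[unfolded aug_def]] by blast
  then have "\<forall>b\<in>B. \<exists>y. y \<in> F \<and> (\<exists>x\<in>X. b = y x)" by blast
  then obtain g where g: "\<And>b. b \<in> B \<Longrightarrow> g b \<in> F \<and> (\<exists>x\<in>X. b = g b x)" by metis
  have "add_span B \<subseteq> aug (g ` B) X"
  proof (rule add_span_least[OF add_subgroup_aug], rule subsetI)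
    fix b assume b: "b \<in> B"
    then obtain x where "x \<in> X" "b = g b x" using g by blast
    then show "b \<in> aug (g ` B) X" using augI[of "g b" "g ` B" x X] b by auto
  qed
  then show ?thesis using that[of "g ` B"] B g by auto
qed

lemma additive_0: "\<forall>u v. y (u + v) = y u + y v \<Longrightarrow> y (0::'v::ab_group_add) = (0::'w::ab_group_add)"
  by (metis add_cancel_right_right)

lemma additive_diff:
  assumes "\<forall>u v. y (u + v) = y u + y v"
  shows "y (u - v) = y (u::'v::ab_group_add) - (y v :: 'w::ab_group_add)"
proof -
  have "y (u - v) + y v = y u" using assms by (metis diff_add_cancel)
  then show ?thesis by (simp add: algebra_simps)
qed

text \<open>The preimage of a subgroup under an additive map is a subgroup, so testing generators
  suffices.\<close>

lemma aug_image_subset: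
  assumes y: "\<forall>u v. y (u + v) = y u + y v" and Z: "add_subgroup Z"
    and "\<And>z x. z \<in> F \<Longrightarrow> x \<in> X \<Longrightarrow> y (z x) \<in> Z" and "w \<in> aug F X"
  shows "y w \<in> Z"
proof -
  have "add_subgroup {w. y w \<in> Z}"
    using additive_0[OF y] additive_diff[OF y] add_subgroupD[OF Z] by (auto simp: add_subgroup_def)
  then have "aug F X \<subseteq> {w. y w \<in> Z}" by (rule aug_least) (use assms(3) in auto)
  then show ?thesis using assms(4) by auto
qed

text \<open>Abstract setting for the operators \<open>\<phi>(f) - 1\<close>. The nilpotency exponent
  is common to all of them, as the counting of letters below requires.\<close>

locale commuting_nilpotent =
  fixes \<Phi> :: "('v::ab_group_add \<Rightarrow> 'v) set" and p :: nat
  assumes additive: "y \<in> \<Phi> \<Longrightarrow> \<forall>u v. y (u + v) = y u + y v"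
    and commute: "y \<in> \<Phi> \<Longrightarrow> z \<in> \<Phi> \<Longrightarrow> y (z v) = z (y v)"
    and nilpotent: "y \<in> \<Phi> \<Longrightarrow> (y ^^ p) v = 0"
begin

definition invariant :: "'v set \<Rightarrow> bool" where
  "invariant X \<longleftrightarrow> (\<forall>y\<in>\<Phi>. \<forall>x\<in>X. y x \<in> X)"

lemma invariantD: "invariant X \<Longrightarrow> y \<in> \<Phi> \<Longrightarrow> x \<in> X \<Longrightarrow> y x \<in> X"
  by (simp add: invariant_def)

lemma invariant_aug:
  assumes "F \<subseteq> \<Phi>" "invariant X"
  shows "invariant (aug F X)"
  unfolding invariant_def
proof (intro ballI)
  fix y w assume y: "y \<in> \<Phi>" and w: "w \<in> aug F X"
  show "y w \<in> aug F X"
  proof (rule aug_image_subset[OF additive[OF y] add_subgroup_aug _ w])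
    fix z x assume "z \<in> F" "x \<in> X"
    then show "y (z x) \<in> aug F X"
      using commute[OF y, of z x] augI[of z F "y x" X] invariantD[OF assms(2) y] assms(1) by auto
  qed
qed

lemma aug_near_subset:
  assumes "add_subgroup Q" "add_subgroup T" "invariant T" "X \<subseteq> near Q' T"
    and "\<And>y q. y \<in> \<Phi> \<Longrightarrow> q \<in> Q' \<Longrightarrow> y q \<in> near Q T"
  shows "aug \<Phi> X \<subseteq> near Q T"
proof (rule aug_least[OF add_subgroup_near[OF assms(1,2)]])
  fix y x assume y: "y \<in> \<Phi>" "x \<in> X"
  then obtain q where q: "q \<in> Q'" "x - q \<in> T" using assms(4) by (auto simp: near_def)
  obtain r where r: "r \<in> Q" "y q - r \<in> T" using assms(5)[OF y(1) q(1)] by (auto simp: near_def)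
  have "y x - y q \<in> T"
    using invariantD[OF assms(3) y(1) q(2)] additive_diff[OF additive[OF y(1)]] by simp
  then have "(y x - y q) + (y q - r) \<in> T" using r add_subgroupD(4)[OF assms(2)] by blast
  then show "y x \<in> near Q T" using r by (auto simp: near_def)
qed

text \<open>Here \<open>fold (\<lambda>y. y) ys v\<close> applies the word \<open>ys\<close> of
  operators to \<open>v\<close>, the head first.\<close>

lemma commute_fold:
  assumes "set ys \<subseteq> \<Phi>" "z \<in> \<Phi>"
  shows "fold (\<lambda>y. y) ys (z v) = z (fold (\<lambda>y. y) ys v)"
  using assms
proof (induction ys arbitrary: v)
  case (Cons a ys)
  then show ?case using commute[of a z v] by simp
qed simp

lemma fold_removeAll:
  assumes "set ys \<subseteq> \<Phi>" "z \<in> \<Phi>"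
  shows "fold (\<lambda>y. y) ys v = (z ^^ count_list ys z) (fold (\<lambda>y. y) (removeAll z ys) v)"
  using assms
proof (induction ys arbitrary: v)
  case (Cons y ys)
  have *: "set (removeAll z ys) \<subseteq> \<Phi>" using Cons.prems by auto
  show ?case using Cons commute_fold[OF * Cons.prems(2)]
    by (auto simp flip: funpow_swap1)
qed auto

text \<open>Pigeonhole: a word longer than \<open>p * card F\<close> uses some letter more than
  \<open>p\<close> times, and commutativity collects these letters into a vanishing power.\<close>

lemma fold_eq_0:
  assumes F: "finite F" "F \<subseteq> \<Phi>" and ys: "set ys \<subseteq> F" "length ys > p * card F"
  shows "fold (\<lambda>y. y) ys v = 0"
proof -
  have "\<exists>z\<in>F. count_list ys z > p"
  proof (rule ccontr)
    assume "\<not> ?thesis"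
    then have "(\<Sum>z\<in>F. count_list ys z) \<le> (\<Sum>z\<in>F. p)"
      by (intro sum_mono) (simp add: leI)
    moreover have "length ys \<le> (\<Sum>z\<in>F. count_list ys z)"
      using sum_count_set[OF ys(1) F(1)] by simp
    ultimately show False using ys(2) by (simp add: mult.commute)
  qed
  then obtain z where z: "z \<in> F" "count_list ys z > p" by blast
  then obtain k where k: "count_list ys z = k + p" by (metis add.commute less_imp_add_positive)
  have zP: "z \<in> \<Phi>" using z F by auto
  have 0: "(z ^^ k) 0 = 0" by (induction k) (auto simp: additive_0[OF additive[OF zP]])
  show ?thesis
    using fold_removeAll[of ys z v] ys F zP by (simp add: k funpow_add nilpotent[OF zP] 0 subset_trans)
qed

lemma aug_funpow_subset:
  assumes "F \<subseteq> \<Phi>"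
  shows "(aug F ^^ r) X \<subseteq> add_span {fold (\<lambda>y. y) ys x |ys x. set ys \<subseteq> F \<and> length ys = r \<and> x \<in> X}"
proof (induction r)
  case 0
  have "X \<subseteq> {fold (\<lambda>y. y) ys x |ys x. set ys \<subseteq> F \<and> length ys = 0 \<and> x \<in> X}" by force
  then show ?case by (auto intro: add_span.base)
next
  case (Suc r)
  let ?P = "\<lambda>r. {fold (\<lambda>y. y) ys x |ys x. set ys \<subseteq> F \<and> length ys = r \<and> x \<in> X}"
  have "aug F ((aug F ^^ r) X) \<subseteq> add_span (?P (Suc r))"
  proof (rule aug_least[OF add_subgroup_add_span])
    fix z x assume z: "z \<in> F" and x: "x \<in> (aug F ^^ r) X"
    have za: "\<forall>u v. z (u + v) = z u + z v" using additive z assms by auto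
    have "add_subgroup {w. z w \<in> add_span (?P (Suc r))}"
      using additive_0[OF za] additive_diff[OF za] add_subgroupD[OF add_subgroup_add_span]
      by (auto simp: add_subgroup_def)
    moreover have "?P r \<subseteq> {w. z w \<in> add_span (?P (Suc r))}"
    proof clarify
      fix ys x assume "set ys \<subseteq> F" "r = length ys" "x \<in> X"
      then have "z (fold (\<lambda>y. y) ys x) \<in> ?P (Suc (length ys))"
        \<comment> \<open>\<open>fold\<close> starts at the head, so the operator applied last goes
          to the end of the word.\<close>
        by (intro CollectI exI[of _ "ys @ [z]"] exI[of _ x]) (use z in auto)
      then show "z (fold (\<lambda>y. y) ys x) \<in> add_span (?P (Suc (length ys)))"
        by (rule add_span.base)
    qed
    ultimately show "z x \<in> add_span (?P (Suc r))"
      using add_span_least x Suc by blast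
  qed
  then show ?case by simp
qed

lemma aug_funpow_eq_0:
  assumes F: "finite F" "F \<subseteq> \<Phi>" and r: "r > p * card F"
  shows "(aug F ^^ r) X \<subseteq> {0}"
proof -
  have "{fold (\<lambda>y. y) ys x |ys x. set ys \<subseteq> F \<and> length ys = r \<and> x \<in> X} \<subseteq> {0}"
    using fold_eq_0[OF F] r by auto
  then have "add_span {fold (\<lambda>y. y) ys x |ys x. set ys \<subseteq> F \<and> length ys = r \<and> x \<in> X} \<subseteq> {0}"
    by (intro add_span_least) (auto simp: add_subgroup_def)
  then show ?thesis using aug_funpow_subset[OF F(2), of r X] by blast
qed

lemma invariant_aug_funpow: "F \<subseteq> \<Phi> \<Longrightarrow> invariant X \<Longrightarrow> invariant ((aug F ^^ r) X)"
  by (induction r) (auto intro: invariant_aug)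

lemma add_subgroup_aug_funpow: "add_subgroup X \<Longrightarrow> add_subgroup ((aug F ^^ r) X)"
  by (induction r) (auto intro: add_subgroup_aug)

text \<open>Commutativity brings each factor from \<open>\<Phi>\<close> next to \<open>X\<close>,
  where \<open>base\<close> trades it for factors from \<open>F\<close> modulo
  \<open>T\<close>.\<close>

lemma aug_funpow_near:
  assumes X: "add_subgroup X" "invariant X" and T: "add_subgroup T" "invariant T"
    and F: "F \<subseteq> \<Phi>" and base: "aug \<Phi> X \<subseteq> near (aug F X) T"
  shows "(aug \<Phi> ^^ r) X \<subseteq> near ((aug F ^^ r) X) T"
proof (induction r)
  case 0
  then show ?case using subset_nearI[OF T(1)] by simp
next
  case (Suc r)
  have step: "y q \<in> near ((aug F ^^ Suc r) X) T" if "y \<in> \<Phi>" "q \<in> (aug F ^^ r) X" for y q r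
    using that
  proof (induction r arbitrary: q)
    case 0
    then show ?case using base augI[of y \<Phi> q X] by auto
  next
    case (Suc r)
    show ?case
    proof (rule aug_image_subset[OF additive[OF Suc.prems(1)]])
      show "q \<in> aug F ((aug F ^^ r) X)" using Suc.prems by simp
      show "add_subgroup (near ((aug F ^^ Suc (Suc r)) X) T)"
        by (intro add_subgroup_near add_subgroup_aug_funpow X T)
      fix z x assume z: "z \<in> F" and x: "x \<in> (aug F ^^ r) X"
      then obtain q where q: "q \<in> (aug F ^^ Suc r) X" "y x - q \<in> T"
        using Suc.IH[OF Suc.prems(1) x] by (auto simp: near_def)
      have "z q \<in> (aug F ^^ Suc (Suc r)) X" using augI[OF z q(1)] by simp
      \<comment> \<open>The difference is \<open>z (y x - q)\<close>, since \<open>y\<close> and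
        \<open>z\<close> commute, and \<open>T\<close> is invariant.\<close>
      moreover have "y (z x) - z q \<in> T"
        using z F commute[OF Suc.prems(1), of z x] additive_diff[OF additive, of z "y x" q]
          invariantD[OF T(2) _ q(2), of z] by auto
      ultimately show "y (z x) \<in> near ((aug F ^^ Suc (Suc r)) X) T" by (auto simp: near_def)
    qed
  qed
  have "aug \<Phi> ((aug \<Phi> ^^ r) X) \<subseteq> near ((aug F ^^ Suc r) X) T"
    by (rule aug_near_subset[where Q' = "(aug F ^^ r) X"])
      (use T Suc step add_subgroup_aug_funpow[OF X(1)] in blast)+
  then show ?case by simp
qed

lemma aug_funpow_subset_of_finite:
  assumes "add_subgroup X" "invariant X" "add_subgroup T" "invariant T"
    and F: "finite F" "F \<subseteq> \<Phi>" and "aug \<Phi> X \<subseteq> near (aug F X) T"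
    and r: "r > p * card F"
  shows "(aug \<Phi> ^^ r) X \<subseteq> T"
proof -
  have "(aug \<Phi> ^^ r) X \<subseteq> near ((aug F ^^ r) X) T"
    using assms by (intro aug_funpow_near)
  also have "\<dots> \<subseteq> near {0} T" by (intro near_mono aug_funpow_eq_0 F r)
  also have "\<dots> \<subseteq> T" by (auto simp: near_def)
  finally show ?thesis .
qed

text \<open>Nakayama's argument: feeding the inclusion into itself pushes the error one application
  of \<open>\<Phi>\<close> deeper, while the invariant group \<open>aug F X\<close> absorbs the
  rest. After \<open>m\<close> rounds the error lies in \<open>T\<close>.\<close>

lemma aug_subset_near_of_second_layer:
  assumes X: "invariant X" and T: "add_subgroup T" "invariant T"
    and F: "F \<subseteq> \<Phi>" and base: "aug \<Phi> X \<subseteq> near (add_span (aug F X \<union> aug \<Phi> (aug \<Phi> X))) T"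
    and m: "(aug \<Phi> ^^ m) (aug \<Phi> X) \<subseteq> T"
  shows "aug \<Phi> X \<subseteq> near (aug F X) T"
proof -
  \<comment> \<open>The error left after \<open>m\<close> rounds, together with
    \<open>T\<close>.\<close>
  let ?T = "\<lambda>m. add_span ((aug \<Phi> ^^ m) (aug \<Phi> X) \<union> T)"
  let ?P = "\<lambda>m. near (aug F X) (?T m)"
  have sub: "add_subgroup (?P m)" for m
    by (intro add_subgroup_near add_subgroup_aug add_subgroup_add_span)
  have T_sub: "?T m \<subseteq> ?P m" for m
    by (rule subset_nearI2[OF add_subgroup_aug])
  have "aug \<Phi> X \<subseteq> ?P m" for m
  proof (induction m)
    case 0
    have "aug \<Phi> X \<subseteq> ?T 0" by (auto intro: add_span.base)
    then show ?case using T_sub[of 0] by blast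
  next
    case (Suc m)
    have "aug \<Phi> (aug \<Phi> X) \<subseteq> ?P (Suc m)"
    proof (rule aug_least[OF sub])
      fix y x assume y: "y \<in> \<Phi>" and "x \<in> aug \<Phi> X"
      then obtain q where q: "q \<in> aug F X" "x - q \<in> ?T m"
        using Suc by (auto simp: near_def)
      have "y (x - q) \<in> ?T (Suc m)"
        by (induction rule: add_span.induct[OF q(2)])
          (auto simp: additive_0[OF additive[OF y]] additive_diff[OF additive[OF y]]
            intro: add_span.intros augI[OF y] y invariantD[OF T(2) y])
      then show "y x \<in> ?P (Suc m)"
        using invariantD[OF invariant_aug[OF F X] y q(1)] additive_diff[OF additive[OF y]]
        by (auto simp: near_def)
    qed
    moreover have "aug F X \<subseteq> ?P (Suc m)" by (rule subset_nearI[OF add_subgroup_add_span])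
    ultimately have "add_span (aug F X \<union> aug \<Phi> (aug \<Phi> X)) \<subseteq> ?P (Suc m)"
      by (intro add_span_least[OF sub]) auto
    moreover have "T \<subseteq> ?P (Suc m)" using T_sub[of "Suc m"] by (blast intro: add_span.base)
    ultimately show ?case using base near_least[OF sub] by blast
  qed
  moreover have "?T m \<subseteq> T"
    by (intro add_span_least T) (use m in auto)
  ultimately show ?thesis unfolding near_def by blast
qed

end

section \<open>Lattices and the Braconnier topology\<close>

lemma dist_fls_less_iff:
  fixes f g :: "'a::group_add fls"
  shows "dist f g < inverse (2 ^ n) \<longleftrightarrow> (\<forall>k\<le>int n. fls_nth f k = fls_nth g k)"
proof (cases "f = g")
  case False
  then have "f - g \<noteq> 0" by simp
  have "dist f g < inverse (2 ^ n) \<longleftrightarrow> fls_subdegree (f - g) > int n"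
  proof (cases "fls_subdegree (f - g) \<ge> 0")
    case True
    then show ?thesis using False by (simp add: dist_fls_def zless_nat_eq_int_zless)
  next
    case F: False
    have "inverse (2 ^ n) \<le> (1::real)" by (simp add: field_simps)
    also have "(1::real) \<le> 2 ^ nat (- fls_subdegree (f - g))" by simp
    finally show ?thesis using False F by (simp add: dist_fls_def)
  qed
  also have "\<dots> \<longleftrightarrow> (\<forall>k\<le>int n. fls_nth (f - g) k = 0)"
  proof
    assume "\<forall>k\<le>int n. fls_nth (f - g) k = 0"
    then show "fls_subdegree (f - g) > int n"
      using nth_fls_subdegree_nonzero[OF \<open>f - g \<noteq> 0\<close>] by (meson not_le)
  next
    assume "fls_subdegree (f - g) > int n"
    then show "\<forall>k\<le>int n. fls_nth (f - g) k = 0"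
      using fls_eq0_below_subdegree[of _ "f - g"] by simp
  qed
  finally show ?thesis by simp
qed simp

text \<open>The group \<open>t^j F_p[[t]]^d\<close>, for any integer \<open>j\<close>. These groups
  form a neighbourhood basis of 0, and continuity is later expressed through them.\<close>

definition lattice :: "int \<Rightarrow> ('n \<Rightarrow> 'a::zero fls) set" where
  "lattice j = {v. \<forall>i. \<forall>k<j. fls_nth (v i) k = 0}"

lemma add_subgroup_lattice: "add_subgroup (lattice j :: ('n \<Rightarrow> 'a::ab_group_add fls) set)"
  by (auto simp: add_subgroup_def lattice_def)

lemma lattice_mono: "j \<le> k \<Longrightarrow> lattice k \<subseteq> lattice j"
  by (auto simp: lattice_def)

lemma open_lattice: "open (lattice j :: ('n::finite \<Rightarrow> 'a::ab_group_add fls) set)"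
proof -
  have "open {f :: 'a fls. \<forall>k<j. fls_nth f k = 0}"
    unfolding open_dist
  proof (intro ballI exI conjI allI impI)
    fix f g :: "'a fls"
    assume f: "f \<in> {f. \<forall>k<j. fls_nth f k = 0}" and "dist g f < inverse (2 ^ nat j)"
    then have "\<forall>k\<le>int (nat j). fls_nth g k = fls_nth f k" by (simp only: dist_fls_less_iff)
    then show "g \<in> {f. \<forall>k<j. fls_nth f k = 0}" using f by auto
  qed simp
  then have "open (\<Pi>\<^sub>E i\<in>(UNIV::'n set). {f :: 'a fls. \<forall>k<j. fls_nth f k = 0})"
    by (intro open_PiE) auto
  also have "(\<Pi>\<^sub>E i\<in>(UNIV::'n set). {f :: 'a fls. \<forall>k<j. fls_nth f k = 0}) = lattice j"
    by (auto simp: lattice_def PiE_iff)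
  finally show ?thesis .
qed

lemma open_fls_contains_ball:
  fixes U :: "'a::ab_group_add fls set"
  assumes "open U" "0 \<in> U"
  obtains n where "\<And>f. \<forall>k<int n. fls_nth f k = 0 \<Longrightarrow> f \<in> U"
proof -
  obtain e where e: "e > 0" "\<And>f. dist f 0 < e \<Longrightarrow> f \<in> U"
    using assms unfolding open_dist by blast
  obtain n where "inverse (2 ^ n) < e"
    using real_arch_pow_inv[OF e(1), of "1/2"] by (auto simp: power_one_over inverse_eq_divide)
  \<comment> \<open>The ball of radius \<open>inverse (2 ^ n)\<close> demands agreement through
    degree \<open>n\<close> inclusive, hence \<open>Suc n\<close>.\<close>
  then have "f \<in> U" if "\<forall>k<int (Suc n). fls_nth f k = 0" for f
    using dist_fls_less_iff[of f 0 n] that by (intro e(2)) auto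
  then show ?thesis using that by blast
qed

lemma open_contains_lattice:
  fixes W :: "('n::finite \<Rightarrow> 'a::ab_group_add fls) set"
  assumes "open W" "0 \<in> W"
  obtains n where "lattice (int n) \<subseteq> W"
proof -
  obtain X where X: "0 \<in> Pi\<^sub>E UNIV X" "\<forall>i. openin euclidean (X i)" "Pi\<^sub>E UNIV X \<subseteq> W"
    using product_topology_open_contains_basis[OF assms(1)[unfolded open_fun_def] assms(2)]
    by blast
  then have 0: "0 \<in> X i" for i
    using PiE_mem[OF X(1), of i] by simp
  have "\<forall>i. \<exists>n. \<forall>f. (\<forall>k<int n. fls_nth f k = 0) \<longrightarrow> f \<in> X i"
    by (rule allI, rule open_fls_contains_ball[OF _ 0]) (use X(2) in auto)
  from choice[OF this] obtain n
    where n: "\<And>i f. \<forall>k<int (n i). fls_nth f k = 0 \<Longrightarrow> f \<in> X i" by blast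
  have "lattice (int (Max (range n))) \<subseteq> Pi\<^sub>E UNIV X"
  proof
    fix v :: "'n \<Rightarrow> 'a fls" assume v: "v \<in> lattice (int (Max (range n)))"
    have "v i \<in> X i" for i
    proof (rule n, intro allI impI)
      fix k assume "k < int (n i)"
      moreover have "n i \<le> Max (range n)" by simp
      ultimately have "k < int (Max (range n))" by linarith
      then show "fls_nth (v i) k = 0" using v by (simp add: lattice_def)
    qed
    then show "v \<in> Pi\<^sub>E UNIV X" by (simp add: PiE_iff)
  qed
  then show ?thesis using X(3) by (intro that[of "Max (range n)"]) (rule subset_trans)
qed

text \<open>The class of an integral vector modulo \<open>t^j\<close>, padded with zeros so that the
  possible values form a finite set of functions.\<close>

definition trunc :: "int \<Rightarrow> ('n \<Rightarrow> 'a::zero fls) \<Rightarrow> 'n \<times> int \<Rightarrow> 'a" where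
  "trunc j v = (\<lambda>(i, k). if 0 \<le> k \<and> k < j then fls_nth (v i) k else 0)"

lemma trunc_eqD:
  fixes u v :: "'n \<Rightarrow> 'a::ab_group_add fls"
  assumes "u \<in> lattice 0" "v \<in> lattice 0" "trunc j u = trunc j v"
  shows "u - v \<in> lattice j"
proof -
  have "fls_nth (u i) k = fls_nth (v i) k" if "k < j" for i k
    using assms(1,2) fun_cong[OF assms(3), of "(i, k)"] that
    by (cases "k < 0") (auto simp: trunc_def lattice_def)
  then show ?thesis by (simp add: lattice_def)
qed

lemma finite_range_trunc: "finite (range (trunc j :: ('n::finite \<Rightarrow> 'a::{zero,finite} fls) \<Rightarrow> _))"
proof (rule finite_subset)
  show "finite {f :: 'n \<times> int \<Rightarrow> 'a. \<forall>x. (x \<in> UNIV \<times> {0..<j} \<longrightarrow> f x \<in> UNIV) \<and> (x \<notin> UNIV \<times> {0..<j} \<longrightarrow> f x = 0)}"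
    by (rule finite_set_of_finite_funs) auto
qed (auto simp: trunc_def)

text \<open>There are finitely many truncations. Choosing preimages within \<open>A\<close> keeps
  the representatives in \<open>A\<close>, as needed for the layers.\<close>

lemma finite_cosets_lattice:
  fixes A :: "('n::finite \<Rightarrow> 'a::{ab_group_add,finite} fls) set"
  assumes "A \<subseteq> lattice 0"
  obtains R where "finite R" "R \<subseteq> A" "\<And>a. a \<in> A \<Longrightarrow> \<exists>r\<in>R. a - r \<in> lattice j"
proof -
  have "finite (trunc j ` A)" by (rule finite_subset[OF _ finite_range_trunc]) auto
  then obtain R where R: "R \<subseteq> A" "finite R" "trunc j ` A = trunc j ` R"
    using finite_subset_image[OF _ order_refl] by metis
  have "\<exists>r\<in>R. a - r \<in> lattice j" if "a \<in> A" for a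
  proof -
    have "trunc j a \<in> trunc j ` R" unfolding R(3)[symmetric] using that by (rule imageI)
    then obtain r where r: "r \<in> R" "trunc j a = trunc j r" by (rule imageE)
    have "a - r \<in> lattice j"
      by (rule trunc_eqD[OF _ _ r(2)]) (use that r(1) R(1) assms in auto)
    then show ?thesis using r(1) by blast
  qed
  then show ?thesis using R(1,2) by (intro that[of R])
qed

text \<open>These series are an isometric copy of the power series, which are complete, and totally
  bounded because the coefficient ring is finite.\<close>

lemma compact_fls_integers: "compact {f :: 'a::{comm_ring_1,finite} fls. \<forall>k<0. fls_nth f k = 0}"
proof -
  let ?S = "{f :: 'a fls. \<forall>k<0. fls_nth f k = 0}"
  have dist: "dist (fps_to_fls f) (fps_to_fls g) = dist f g" for f g :: "'a fps"
    by (simp add: dist_fls_def dist_fps_def fls_subdegree_fls_to_fps flip: fps_to_fls_minus)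
  have range: "?S = range fps_to_fls"
  proof (intro equalityI subsetI)
    fix f :: "'a fls" assume "f \<in> ?S"
    then have "f = fps_to_fls (fls_regpart f)" by (intro fls_eqI) auto
    then show "f \<in> range fps_to_fls" by blast
  qed auto
  have "compact (UNIV :: 'a fps set)"
    unfolding compact_eq_totally_bounded
  proof (intro conjI allI impI)
    show "complete (UNIV :: 'a fps set)" by (rule complete_UNIV)
    fix e :: real assume "e > 0"
    then obtain n where n: "inverse (2 ^ n) < e"
      using real_arch_pow_inv[of e "1/2"] by (auto simp: power_one_over inverse_eq_divide)
    let ?K = "(\<lambda>c. Abs_fps c) ` {c :: nat \<Rightarrow> 'a. \<forall>x. (x \<in> {..n} \<longrightarrow> c x \<in> UNIV) \<and> (x \<notin> {..n} \<longrightarrow> c x = 0)}"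
    have "finite ?K" by (intro finite_imageI finite_set_of_finite_funs) auto
    moreover have "f \<in> (\<Union>x\<in>?K. ball x e)" for f :: "'a fps"
    proof (rule UN_I)
      let ?g = "Abs_fps (\<lambda>k. if k \<le> n then fps_nth f k else 0)"
      show "?g \<in> ?K" by (intro imageI) auto
      have "dist ?g f < inverse (2 ^ n)" by (simp add: dist_less_eq_nth_equal)
      then show "f \<in> ball ?g e" using n by simp
    qed
    ultimately show "\<exists>k. finite k \<and> (UNIV :: 'a fps set) \<subseteq> (\<Union>x\<in>k. ball x e)" by blast
  qed
  moreover have "continuous_on UNIV (fps_to_fls :: 'a fps \<Rightarrow> 'a fls)"
    by (rule continuous_onI) (use dist in auto)
  ultimately show ?thesis unfolding range by (metis compact_continuous_image)
qed

lemma compact_lattice_0: "compact (lattice 0 :: ('n::finite \<Rightarrow> 'a::{comm_ring_1,finite} fls) set)"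
proof -
  have "compactin (product_topology (\<lambda>i. euclidean) UNIV)
      (\<Pi>\<^sub>E i\<in>(UNIV::'n set). {f :: 'a fls. \<forall>k<0. fls_nth f k = 0})"
    by (simp add: compactin_PiE compact_fls_integers)
  also have "(\<Pi>\<^sub>E i\<in>(UNIV::'n set). {f :: 'a fls. \<forall>k<0. fls_nth f k = 0}) = lattice 0"
    by (auto simp: lattice_def PiE_iff)
  finally show ?thesis by (simp add: euclidean_product_topology)
qed

text \<open>The neighbourhood is a subgroup of the automorphism group, so it contains
  a neighbourhood of each of its points.\<close>

lemma braconnier_open_nbhd_lattice:
  assumes "j \<ge> 0"
  shows "braconnier_open (braconnier_nbhd (lattice 0) (lattice j) :: (('n::finite \<Rightarrow> 'a::{field,finite} fls) \<Rightarrow> _) set)"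
  unfolding braconnier_open_def
proof (intro conjI ballI)
  let ?N = "braconnier_nbhd (lattice 0) (lattice j) :: (('n \<Rightarrow> 'a fls) \<Rightarrow> _) set"
  show "?N \<subseteq> top_group_aut" by (auto simp: braconnier_nbhd_def)
  note sub = add_subgroupD[OF add_subgroup_lattice]
  have L: "x \<in> lattice j \<Longrightarrow> x \<in> lattice 0" for x :: "'n \<Rightarrow> 'a fls"
    using lattice_mono[OF assms] by blast
  \<comment> \<open>Members of \<open>?N\<close> preserve \<open>lattice 0\<close> because
    \<open>j \<ge> 0\<close>, so the estimates for two of them can be chained there.\<close>
  have maps0: "\<beta> x \<in> lattice 0" "inv \<beta> x \<in> lattice 0" if "\<beta> \<in> ?N" "x \<in> lattice 0" for \<beta> x
  proof -
    have "\<beta> x - x \<in> lattice 0" "inv \<beta> x - x \<in> lattice 0" using that L by (auto simp: braconnier_nbhd_def)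
    from sub(4)[OF this(1) that(2)] sub(4)[OF this(2) that(2)]
    show "\<beta> x \<in> lattice 0" "inv \<beta> x \<in> lattice 0" by auto
  qed
  fix \<alpha> :: "('n \<Rightarrow> 'a fls) \<Rightarrow> _" assume \<alpha>: "\<alpha> \<in> ?N"
  have "identity_nbhd (lattice j :: ('n \<Rightarrow> 'a fls) set)"
    unfolding identity_nbhd_def using open_lattice sub(1) by blast
  moreover have "{\<beta> \<in> top_group_aut. inv \<alpha> \<circ> \<beta> \<in> ?N} \<subseteq> ?N"
  proof clarify
    fix \<beta> assume \<beta>: "\<beta> \<in> top_group_aut" and \<gamma>: "inv \<alpha> \<circ> \<beta> \<in> ?N"
    let ?\<gamma> = "inv \<alpha> \<circ> \<beta>"
    have bij: "bij \<alpha>" "bij \<beta>" "bij ?\<gamma>"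
      using \<alpha> \<beta> \<gamma> by (auto simp: braconnier_nbhd_def top_group_aut_def)
    have \<beta>_eq: "\<beta> x = \<alpha> (?\<gamma> x)" for x using bij by (simp add: bij_is_surj surj_f_inv_f)
    have inv_eq: "inv \<beta> x = inv ?\<gamma> (inv \<alpha> x)" for x
      using bij by (metis \<beta>_eq bij_inv_eq_iff)
    have "\<beta> x - x \<in> lattice j \<and> inv \<beta> x - x \<in> lattice j" if x: "x \<in> lattice 0" for x
    proof
      have "\<alpha> (?\<gamma> x) - ?\<gamma> x \<in> lattice j" "?\<gamma> x - x \<in> lattice j"
        using \<alpha> \<gamma> x maps0[OF \<gamma> x] by (auto simp: braconnier_nbhd_def)
      from sub(4)[OF this] show "\<beta> x - x \<in> lattice j" by (simp only: \<beta>_eq) simp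
      have "inv ?\<gamma> (inv \<alpha> x) - inv \<alpha> x \<in> lattice j" "inv \<alpha> x - x \<in> lattice j"
        using \<alpha> \<gamma> x maps0[OF \<alpha> x] by (auto simp: braconnier_nbhd_def)
      from sub(4)[OF this] show "inv \<beta> x - x \<in> lattice j" by (simp add: inv_eq)
    qed
    then show "\<beta> \<in> ?N" using \<beta> by (simp add: braconnier_nbhd_def)
  qed
  ultimately show "\<exists>K U. compact K \<and> identity_nbhd U \<and>
      {\<beta> \<in> top_group_aut. inv \<alpha> \<circ> \<beta> \<in> braconnier_nbhd K U} \<subseteq> ?N"
    using compact_lattice_0 by blast
qed

text \<open>The preimage of an open neighbourhood of the identity is open and contains 0. The bound
  is uniform in \<open>x\<close>; in this form the continuity of \<open>\<phi>\<close> enters the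
  proof.\<close>

lemma braconnier_continuous_small:
  fixes \<phi> :: "'a::{field,finite} fls \<Rightarrow> (('n::finite \<Rightarrow> 'a fls) \<Rightarrow> ('n \<Rightarrow> 'a fls))"
  assumes "braconnier_continuous \<phi>" "\<phi> 0 = id" "j \<ge> 0"
  obtains n where "\<And>f x. \<forall>k<int n. fls_nth f k = 0 \<Longrightarrow> x \<in> lattice 0 \<Longrightarrow> \<phi> f x - x \<in> lattice j"
proof -
  let ?N = "braconnier_nbhd (lattice 0) (lattice j) :: (('n \<Rightarrow> 'a fls) \<Rightarrow> _) set"
  have "open {f. \<phi> f \<in> ?N}"
    using assms(1) by (simp add: braconnier_continuous_def braconnier_open_nbhd_lattice[OF assms(3)])
  moreover have "0 \<in> {f. \<phi> f \<in> ?N}"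
    by (simp add: braconnier_nbhd_def top_group_aut_def assms(2) inv_id continuous_on_id'
        add_subgroupD(1)[OF add_subgroup_lattice])
  ultimately obtain n where "\<And>f. \<forall>k<int n. fls_nth f k = 0 \<Longrightarrow> f \<in> {f. \<phi> f \<in> ?N}"
    by (rule open_fls_contains_ball) blast
  then show ?thesis by (intro that[of n]) (auto simp: braconnier_nbhd_def)
qed

lemma continuous_additive_lattice:
  fixes \<alpha> :: "('n::finite \<Rightarrow> 'a::ab_group_add fls) \<Rightarrow> ('n \<Rightarrow> 'a fls)"
  assumes "continuous_on UNIV \<alpha>" "\<alpha> 0 = 0"
  obtains n where "\<And>x. x \<in> lattice (int n) \<Longrightarrow> \<alpha> x \<in> lattice j"
proof -
  have "open (\<alpha> -` lattice j)"
    using assms(1) by (simp add: continuous_on_open_vimage open_lattice)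
  moreover have "0 \<in> \<alpha> -` lattice j"
    using assms(2) add_subgroupD(1)[OF add_subgroup_lattice] by simp
  ultimately obtain n where "lattice (int n) \<subseteq> \<alpha> -` lattice j"
    by (rule open_contains_lattice)
  then show ?thesis by (intro that[of n]) auto
qed

section \<open>Additive maps in prime characteristic\<close>

text \<open>Translation by 1 permutes the finite ring, so it does not change the sum of all
  elements.\<close>

lemma of_nat_CARD_eq_0: "of_nat CARD('a) = (0 :: 'a::{ring_1,finite})"
proof -
  have "(\<Sum>x\<in>UNIV. x + 1) = (\<Sum>x\<in>UNIV. x :: 'a)"
    by (rule sum.reindex_bij_betw) (rule bij_plus_right)
  then show ?thesis by (simp add: sum.distrib)
qed

lemma additive_of_nat_mult:
  fixes y :: "'v::comm_ring_1 \<Rightarrow> 'v"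
  assumes "\<forall>u v. y (u + v) = y u + y v"
  shows "y (of_nat n * v) = of_nat n * y v"
  by (induction n) (simp_all add: additive_0[OF assms] assms ring_distribs)

lemma additive_sum:
  fixes y :: "'v::ab_group_add \<Rightarrow> 'w::ab_group_add"
  assumes "\<forall>u v. y (u + v) = y u + y v"
  shows "y (\<Sum>k\<in>A. g k) = (\<Sum>k\<in>A. y (g k))"
  by (induction A rule: infinite_finite_induct) (simp_all add: additive_0[OF assms] assms)

text \<open>The identity commutes with \<open>y\<close>, so this is the binomial theorem for the
  operator \<open>1 + y\<close>, by Pascal's rule. The ring type allows integer multiples to be
  written as products.\<close>

lemma binomial_additive:
  fixes y :: "'v::comm_ring_1 \<Rightarrow> 'v"
  assumes "\<forall>u v. y (u + v) = y u + y v"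
  shows "((\<lambda>v. v + y v) ^^ n) v = (\<Sum>k\<le>n. of_nat (n choose k) * (y ^^ k) v)"
proof (induction n)
  case (Suc n)
  let ?t = "\<lambda>m k. of_nat (m choose k) * (y ^^ k) v"
  have "y (\<Sum>k\<le>n. ?t n k) = (\<Sum>k\<le>n. of_nat (n choose k) * (y ^^ Suc k) v)"
    by (simp add: additive_sum[OF assms] additive_of_nat_mult[OF assms])
  moreover have "(\<Sum>k\<le>n. ?t n k) = v + (\<Sum>k\<le>n. of_nat (n choose Suc k) * (y ^^ Suc k) v)"
    using sum.atMost_Suc[of "?t n" n] unfolding sum.atMost_Suc_shift[of "?t n" n]
    by (simp add: binomial_eq_0)
  moreover have "(\<Sum>k\<le>Suc n. ?t (Suc n) k)
      = v + (\<Sum>k\<le>n. of_nat (n choose Suc k) * (y ^^ Suc k) v)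
          + (\<Sum>k\<le>n. of_nat (n choose k) * (y ^^ Suc k) v)"
    unfolding sum.atMost_Suc_shift[of "?t (Suc n)" n]
    by (simp add: ring_distribs sum.distrib del: funpow.simps)
  ultimately show ?case using Suc by simp
qed simp

text \<open>The inner binomial coefficients are divisible by \<open>p\<close>, so
  \<open>(1 + y)^p = 1 + y^p\<close>.\<close>

lemma funpow_prime_char_additive:
  fixes y :: "'v::comm_ring_1 \<Rightarrow> 'v"
  assumes "\<forall>u v. y (u + v) = y u + y v" "prime p" "of_nat p = (0 :: 'v)"
  shows "((\<lambda>v. v + y v) ^^ p) v = v + (y ^^ p) v"
proof -
  let ?t = "\<lambda>k. of_nat (p choose k) * (y ^^ k) v"
  have "?t k = 0" if "k \<in> {..p} - {0, p}" for k
  proof -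
    have "p dvd (p choose k)" by (rule dvd_choose_prime) (use that assms(2) in auto)
    then show ?thesis using assms(3) by (auto elim!: dvdE)
  qed
  then have "(\<Sum>k\<le>p. ?t k) = (\<Sum>k\<in>{0, p}. ?t k)"
    by (intro sum.mono_neutral_right) auto
  also have "\<dots> = v + (y ^^ p) v" using prime_gt_0_nat[OF assms(2)] by simp
  finally show ?thesis using binomial_additive[OF assms(1), of p v] by simp
qed

section \<open>Leading coefficients of shift-invariant subgroups\<close>

definition shift :: "('n \<Rightarrow> 'a::comm_ring_1 fls) \<Rightarrow> 'n \<Rightarrow> 'a fls" where
  "shift v = (\<lambda>i. fls_X * v i)"

lemma fls_nth_shift [simp]: "fls_nth (shift v i) k = fls_nth (v i) (k - 1)"
  by (simp add: shift_def fls_X_times_conv_shift)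

lemma shift_add: "shift (u + v) = shift u + shift v"
  by (simp add: shift_def fun_eq_iff ring_distribs)

text \<open>The image of \<open>A \<inter> lattice j\<close> in \<open>lattice j\<close> modulo
  \<open>lattice (j + 1)\<close>, read as coefficient vectors; the zero vector may occur.\<close>

definition lead :: "int \<Rightarrow> ('n \<Rightarrow> 'a::zero fls) set \<Rightarrow> ('n \<Rightarrow> 'a) set" where
  "lead j A = (\<lambda>v i. fls_nth (v i) j) ` (A \<inter> lattice j)"

lemma lead_shift:
  assumes "\<And>v. v \<in> A \<Longrightarrow> shift v \<in> A" "j \<le> k"
  shows "lead j A \<subseteq> lead k A"
  using assms(2)
proof (induction k rule: int_ge_induct)
  case (step k)
  have "lead k A \<subseteq> lead (k + 1) A"
    unfolding lead_def
  proof clarify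
    fix v assume v: "v \<in> A" "v \<in> lattice k"
    then have "shift v \<in> A \<inter> lattice (k + 1)" using assms(1) by (auto simp: lattice_def)
    moreover have "(\<lambda>i. fls_nth (v i) k) = (\<lambda>i. fls_nth (shift v i) (k + 1))" by simp
    ultimately show "(\<lambda>i. fls_nth (v i) k) \<in> (\<lambda>v i. fls_nth (v i) (k + 1)) ` (A \<inter> lattice (k + 1))"
      by blast
  qed
  then show ?case using step by blast
qed simp

text \<open>Successive approximation: an element of \<open>B\<close> cancels the lowest term of the
  remainder, which stays in \<open>A\<close> because \<open>B \<subseteq> A\<close>.\<close>

lemma subset_near_of_lead:
  fixes A B :: "('n \<Rightarrow> 'a::ab_group_add fls) set"
  assumes A: "add_subgroup A" and B: "add_subgroup B" "B \<subseteq> A"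
    and lead: "\<And>k. k \<ge> j \<Longrightarrow> lead k A \<subseteq> lead k B"
  shows "A \<inter> lattice j \<subseteq> near B (lattice i)"
proof
  fix x assume x: "x \<in> A \<inter> lattice j"
  have "\<exists>b\<in>B. x - b \<in> lattice (j + int n)" for n
  proof (induction n)
    case 0
    then show ?case using x add_subgroupD(1)[OF B(1)] by (auto intro!: bexI[of _ 0])
  next
    case (Suc n)
    then obtain b where b: "b \<in> B" "x - b \<in> lattice (j + int n)" by blast
    have "x - b \<in> A" using x b B add_subgroupD(2)[OF A] by blast
    then have "(\<lambda>i. fls_nth ((x - b) i) (j + int n)) \<in> lead (j + int n) A"
      using b unfolding lead_def by blast
    then obtain c where c: "c \<in> B" "c \<in> lattice (j + int n)"
      "(\<lambda>i. fls_nth ((x - b) i) (j + int n)) = (\<lambda>i. fls_nth (c i) (j + int n))"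
      using lead[of "j + int n"] unfolding lead_def by fastforce
    have "fls_nth ((x - (b + c)) i) k = 0" if "k < j + int (Suc n)" for i k
    proof (cases "k = j + int n")
      case True
      then show ?thesis using fun_cong[OF c(3), of i] by (simp add: algebra_simps)
    next
      case False
      then have "k < j + int n" using that by simp
      then show ?thesis using b(2) c(2) by (simp add: lattice_def diff_diff_eq[symmetric])
    qed
    then have "x - (b + c) \<in> lattice (j + int (Suc n))" by (simp add: lattice_def)
    then show ?case using add_subgroupD(4)[OF B(1) b(1) c(1)] by blast
  qed
  then obtain b where b: "b \<in> B" "x - b \<in> lattice (j + int (nat (i - j)))" by blast
  moreover have "lattice (j + int (nat (i - j))) \<subseteq> lattice i" by (rule lattice_mono) simp
  ultimately have "x - b \<in> lattice i" by blast
  then show "x \<in> near B (lattice i)" using b by (auto simp: near_def)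
qed

text \<open>Leading coefficients come from a finite set, so two consecutive groups have the same
  ones, and by shifting the same ones in each large degree. Both \<open>k\<close> and
  \<open>j\<close> are found before \<open>i\<close> is given.\<close>

lemma descending_chain_dense:
  fixes A :: "nat \<Rightarrow> ('n::finite \<Rightarrow> 'a::{comm_ring_1,finite} fls) set"
  assumes sub: "\<And>m. add_subgroup (A m)" and shift: "\<And>m v. v \<in> A m \<Longrightarrow> shift v \<in> A m"
    and dec: "\<And>m. A (Suc m) \<subseteq> A m"
  obtains k j where "\<And>i. A k \<inter> lattice j \<subseteq> near (A (Suc k)) (lattice i)"
proof -
  define E where "E m = (\<Union>j. lead j (A m))" for m
  have "E (Suc m) \<subseteq> E m" for m
    using dec[of m] unfolding E_def lead_def by blast
  moreover obtain k where "\<forall>m. card (E k) \<le> card (E m)"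
    using ex_has_least_nat[of "\<lambda>_. True" 0 "\<lambda>m. card (E m)"] by auto
  ultimately have E: "E (Suc k) = E k" by (intro card_seteq) auto
  have "\<forall>c. \<exists>j. c \<in> E k \<longrightarrow> c \<in> lead j (A (Suc k))"
    unfolding E[symmetric] unfolding E_def by blast
  \<comment> \<open>\<open>f c\<close> is a degree in which the smaller group already attains
    \<open>c\<close>. Outside \<open>E k\<close> its value is arbitrary and can only enlarge
    \<open>j\<close>.\<close>
  from choice[OF this] obtain f where f: "\<And>c. c \<in> E k \<Longrightarrow> c \<in> lead (f c) (A (Suc k))" by blast
  define j where "j = Max (range f)"
  have "lead l (A k) \<subseteq> lead l (A (Suc k))" if "l \<ge> j" for l
  proof
    fix c assume "c \<in> lead l (A k)"
    then have "c \<in> E k" by (auto simp: E_def)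
    then have "c \<in> lead (f c) (A (Suc k))" by (rule f)
    moreover have "f c \<le> l" using that Max_ge[of "range f" "f c"] unfolding j_def by simp
    ultimately show "c \<in> lead l (A (Suc k))"
      using lead_shift[OF shift, of "Suc k" "f c" l] by blast
  qed
  note lead_subset = this
  show ?thesis
    by (rule that[of k j], rule subset_near_of_lead[OF sub sub dec lead_subset])
qed

definition integral_fls :: "'a::zero fls \<Rightarrow> bool" where
  "integral_fls f \<longleftrightarrow> (\<forall>k<0. fls_nth f k = 0)"

lemma finite_cosets_integral_fls:
  obtains E :: "'a::{ab_group_add,finite} fls set" where "finite E" "\<And>e. e \<in> E \<Longrightarrow> integral_fls e"
    "\<And>f. integral_fls f \<Longrightarrow> \<exists>e\<in>E. \<forall>k<j. fls_nth (f - e) k = 0"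
proof -
  \<comment> \<open>A series is viewed as a vector over a one-point index type, so that the coset
    lemma for lattices applies.\<close>
  let ?A = "(\<lambda>f. (\<lambda>_. f)) ` Collect integral_fls :: (unit \<Rightarrow> 'a fls) set"
  have "?A \<subseteq> lattice 0" by (auto simp: lattice_def integral_fls_def)
  then obtain R where R: "finite R" "R \<subseteq> ?A" "\<And>a. a \<in> ?A \<Longrightarrow> \<exists>r\<in>R. a - r \<in> lattice j"
    by (rule finite_cosets_lattice[where j = j]) blast
  show ?thesis
  proof (rule that[of "(\<lambda>r. r ()) ` R"])
    show "finite ((\<lambda>r. r ()) ` R)" using R(1) by simp
    show "integral_fls e" if "e \<in> (\<lambda>r. r ()) ` R" for e using that R(2) by auto
    fix f :: "'a fls" assume "integral_fls f"
    then obtain r where "r \<in> R" "(\<lambda>_. f) - r \<in> lattice j" using R(3)[of "\<lambda>_. f"] by blast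
    then show "\<exists>e\<in>(\<lambda>r. r ()) ` R. \<forall>k<j. fls_nth (f - e) k = 0"
      by (intro bexI[of _ "r ()"]) (auto simp: lattice_def)
  qed
qed

section \<open>The contractive action\<close>

text \<open>The situation after rescaling: \<open>\<psi> f\<close> will be \<open>\<phi>\<close> at
  \<open>t^N f\<close>, with \<open>N\<close> chosen to secure \<open>preserve\<close>. Continuity
  is split into that of each operator and, in \<open>small\<close>, uniform continuity at
  \<open>f = 0\<close> on the lattice.\<close>

locale contractive_action =
  fixes \<psi> :: "'a::{field,finite} fls \<Rightarrow> ('n::finite \<Rightarrow> 'a fls) \<Rightarrow> ('n \<Rightarrow> 'a fls)"
  assumes prime: "prime CARD('a)"
    and action_add: "\<forall>u v. \<psi> f (u + v) = \<psi> f u + \<psi> f v"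
    and action_plus: "\<psi> (f + g) v = \<psi> f (\<psi> g v)"
    and action_zero: "\<psi> 0 v = v"
    and continuous: "\<exists>n. \<forall>x\<in>lattice (int n). \<psi> f x \<in> lattice i"
    and small: "i \<ge> 0 \<Longrightarrow> \<exists>n. \<forall>f. \<forall>x\<in>lattice 0. (\<forall>k<int n. fls_nth f k = 0) \<longrightarrow> \<psi> f x - x \<in> lattice i"
    and preserve: "integral_fls f \<Longrightarrow> x \<in> lattice 0 \<Longrightarrow> \<psi> f x \<in> lattice 0"
    and equivariant: "\<psi> (fls_X * f) (shift v) = shift (\<psi> f v)"
begin

definition delta :: "'a fls \<Rightarrow> ('n \<Rightarrow> 'a fls) \<Rightarrow> ('n \<Rightarrow> 'a fls)" where
  "delta f v = \<psi> f v - v"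

definition ops :: "(('n \<Rightarrow> 'a fls) \<Rightarrow> ('n \<Rightarrow> 'a fls)) set" where
  "ops = delta ` Collect integral_fls"

lemma action_diff: "\<psi> f (u - v) = \<psi> f u - \<psi> f v"
  by (rule additive_diff[OF action_add])

lemma action_0: "\<psi> f 0 = 0"
  by (rule additive_0[OF action_add])

lemma additive_delta: "\<forall>u v. delta f (u + v) = delta f u + delta f v"
  using action_add[of f] by (simp add: delta_def)

lemma commute_action: "\<psi> f (\<psi> g v) = \<psi> g (\<psi> f v)"
  by (metis action_plus add.commute)

lemma integral_fls_add: "integral_fls f \<Longrightarrow> integral_fls g \<Longrightarrow> integral_fls (f + g :: 'a fls)"
  by (simp add: integral_fls_def)

lemma integral_fls_zero: "integral_fls (0 :: 'a fls)"
  by (simp add: integral_fls_def)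

lemma funpow_action: "(\<psi> f ^^ n) v = \<psi> (of_nat n * f) v"
  by (induction n) (simp_all add: action_zero action_plus ring_distribs)

text \<open>The \<open>p\<close>-th power of \<open>1 + delta f\<close> is
  \<open>1 + (delta f)^p\<close>, but it is also the action of \<open>p f = 0\<close>, the
  identity.\<close>

lemma nilpotent_delta: "(delta f ^^ CARD('a)) v = 0"
proof -
  have 0: "of_nat CARD('a) = (0 :: 'a fls)"
    by (simp add: fls_of_nat of_nat_CARD_eq_0)
  then have "of_nat CARD('a) = (0 :: 'n \<Rightarrow> 'a fls)"
    by (simp add: of_nat_fun zero_fun_def)
  moreover have "(\<lambda>v. v + delta f v) = \<psi> f" by (simp add: delta_def)
  ultimately have "(\<psi> f ^^ CARD('a)) v = v + (delta f ^^ CARD('a)) v"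
    using funpow_prime_char_additive[OF additive_delta prime, of f v] by metis
  then show ?thesis by (simp add: funpow_action 0 action_zero)
qed

sublocale commuting_nilpotent ops "CARD('a)"
proof
  fix y z :: "('n \<Rightarrow> 'a fls) \<Rightarrow> ('n \<Rightarrow> 'a fls)" and v
  assume y: "y \<in> ops"
  then obtain f where f: "y = delta f" by (auto simp: ops_def)
  show "\<forall>u v. y (u + v) = y u + y v" using additive_delta f by simp
  show "(y ^^ CARD('a)) v = 0" using nilpotent_delta f by simp
  assume "z \<in> ops"
  then obtain g where "z = delta g" by (auto simp: ops_def)
  then show "y (z v) = z (y v)" using f by (simp add: delta_def action_diff commute_action[of f g])
qed

section \<open>The layers and the invariant neighbourhoods of zero\<close>

abbreviation layer :: "nat \<Rightarrow> ('n \<Rightarrow> 'a fls) set" where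
  "layer m \<equiv> (aug ops ^^ m) (lattice 0)"

lemma invariant_lattice: "invariant (lattice 0)"
  unfolding invariant_def
proof (intro ballI)
  fix y and x :: "'n \<Rightarrow> 'a fls" assume "y \<in> ops" and x: "x \<in> lattice 0"
  then obtain f where "integral_fls f" "y = delta f" by (auto simp: ops_def)
  then show "y x \<in> lattice 0"
    using add_subgroupD(2)[OF add_subgroup_lattice _ x] preserve x by (simp add: delta_def)
qed

lemma invariant_layer: "invariant (layer m)"
  by (rule invariant_aug_funpow[OF order_refl invariant_lattice])

lemma add_subgroup_layer: "add_subgroup (layer m)"
  by (rule add_subgroup_aug_funpow[OF add_subgroup_lattice])

lemma layer_Suc_subset: "layer (Suc m) \<subseteq> layer m"
  using aug_least[OF add_subgroup_layer] invariantD[OF invariant_layer] by simp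

lemma layer_antimono: "m \<le> n \<Longrightarrow> layer n \<subseteq> layer m"
  by (rule lift_Suc_antimono_le[of layer]) (rule layer_Suc_subset)

text \<open>Equivariance turns \<open>shift (delta f x)\<close> into
  \<open>delta (fls_X * f) (shift x)\<close>, and \<open>fls_X * f\<close> is again
  integral.\<close>

lemma shift_layer: "v \<in> layer m \<Longrightarrow> shift v \<in> layer m"
proof (induction m arbitrary: v)
  case 0
  then show ?case by (auto simp: lattice_def)
next
  case (Suc m)
  show ?case
  proof (rule aug_image_subset[where y = shift])
    show "v \<in> aug ops (layer m)" using Suc.prems by simp
    show "\<forall>u v. shift (u + v) = shift u + shift v" by (simp add: shift_add)
    show "add_subgroup (layer (Suc m))" by (rule add_subgroup_layer)
    fix z x assume z: "z \<in> ops" and x: "x \<in> layer m"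
    from z obtain f where f: "integral_fls f" "z = delta f" by (auto simp: ops_def)
    have "shift (z x) = delta (fls_X * f) (shift x)"
      by (simp add: f(2) delta_def equivariant additive_diff[where y = shift] shift_add)
    moreover have "delta (fls_X * f) \<in> ops"
      using f(1) by (auto simp: ops_def integral_fls_def fls_X_times_conv_shift)
    ultimately show "shift (z x) \<in> layer (Suc m)" using augI Suc.IH[OF x] by auto
  qed
qed

text \<open>The closure in the header is taken with respect to these neighbourhoods: being invariant,
  they make closure compatible with the operators.\<close>

definition core :: "int \<Rightarrow> ('n \<Rightarrow> 'a fls) set" where
  "core i = {x \<in> lattice 0. \<forall>f. integral_fls f \<longrightarrow> \<psi> f x \<in> lattice i}"

lemma core_subset: "core i \<subseteq> lattice i"
  using action_zero integral_fls_zero by (force simp: core_def)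

lemma add_subgroup_core: "add_subgroup (core i)"
  by (simp add: add_subgroup_def core_def action_diff action_0
      add_subgroupD(1,2)[OF add_subgroup_lattice])

lemma invariant_core: "invariant (core i)"
  unfolding invariant_def
proof (intro ballI)
  fix y x assume "y \<in> ops" and x: "x \<in> core i"
  then obtain f where f: "integral_fls f" "y = delta f" by (auto simp: ops_def)
  have "\<psi> f x \<in> core i"
    using x preserve[OF f(1)] integral_fls_add[OF _ f(1)] by (auto simp: core_def action_plus[symmetric])
  then show "y x \<in> core i" using add_subgroupD(2)[OF add_subgroup_core _ x] f by (simp add: delta_def)
qed

text \<open>By \<open>small\<close>, the operator modulo \<open>lattice i\<close> depends only on
  \<open>f\<close> modulo a power of \<open>t\<close>, which leaves finitely many classes.\<close>

lemma finite_action_modulo: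
  assumes "i \<ge> 0"
  obtains E where "finite E" "\<And>e. e \<in> E \<Longrightarrow> integral_fls e"
    "\<And>f. integral_fls f \<Longrightarrow> \<exists>e\<in>E. \<forall>x\<in>lattice 0. \<psi> f x - \<psi> e x \<in> lattice i"
proof -
  obtain n where n: "\<And>f x. x \<in> lattice 0 \<Longrightarrow> \<forall>k<int n. fls_nth f k = 0 \<Longrightarrow> \<psi> f x - x \<in> lattice i"
    using small[OF assms] by blast
  obtain E :: "'a fls set" where E: "finite E" "\<And>e. e \<in> E \<Longrightarrow> integral_fls e"
    "\<And>f. integral_fls f \<Longrightarrow> \<exists>e\<in>E. \<forall>k<int n. fls_nth (f - e) k = 0"
    by (rule finite_cosets_integral_fls[where j = "int n"]) blast
  have "\<exists>e\<in>E. \<forall>x\<in>lattice 0. \<psi> f x - \<psi> e x \<in> lattice i" if f: "integral_fls f" for f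
  proof -
    obtain e where e: "e \<in> E" "\<forall>k<int n. fls_nth (f - e) k = 0" using E(3)[OF f] by blast
    have "\<psi> f x - \<psi> e x \<in> lattice i" if "x \<in> lattice 0" for x
    proof -
      have "\<psi> f x = \<psi> (f - e) (\<psi> e x)" by (simp add: action_plus[symmetric])
      then show ?thesis using n[OF preserve[OF E(2)[OF e(1)] that] e(2)] by simp
    qed
    then show ?thesis using e(1) by blast
  qed
  then show ?thesis using E(1,2) by (intro that[of E])
qed

text \<open>Thus \<open>core i\<close> is a neighbourhood of 0: modulo \<open>lattice i\<close>
  finitely many operators matter, and each is continuous.\<close>

lemma lattice_subset_core:
  assumes "i \<ge> 0"
  obtains j where "lattice j \<subseteq> core i"
proof -
  obtain E where E: "finite E" "\<And>e. e \<in> E \<Longrightarrow> integral_fls e"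
    "\<And>f. integral_fls f \<Longrightarrow> \<exists>e\<in>E. \<forall>x\<in>lattice 0. \<psi> f x - \<psi> e x \<in> lattice i"
    by (rule finite_action_modulo[OF assms]) blast
  have "\<forall>e. \<exists>n. \<forall>x\<in>lattice (int n). \<psi> e x \<in> lattice i" using continuous by blast
  from choice[OF this] obtain n where n: "\<And>e x. x \<in> lattice (int (n e)) \<Longrightarrow> \<psi> e x \<in> lattice i" by blast
  define N where "N = (\<Sum>e\<in>E. n e)"
  have "lattice (int N) \<subseteq> core i"
  proof
    fix x :: "'n \<Rightarrow> 'a fls" assume x: "x \<in> lattice (int N)"
    have x0: "x \<in> lattice 0" using x lattice_mono[of 0 "int N"] by auto
    have "\<psi> f x \<in> lattice i" if f: "integral_fls f" for f
    proof -
      obtain e where e: "e \<in> E" "\<psi> f x - \<psi> e x \<in> lattice i" using E(3)[OF f] x0 by blast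
      have "n e \<le> N" unfolding N_def using member_le_sum[of e E n] E(1) e(1) by simp
      then have "\<psi> e x \<in> lattice i" using n x lattice_mono[of "int (n e)" "int N"] by auto
      from add_subgroupD(4)[OF add_subgroup_lattice e(2) this] show ?thesis by simp
    qed
    then show "x \<in> core i" using x0 by (simp add: core_def)
  qed
  then show ?thesis by (rule that)
qed

text \<open>Modulo \<open>core i\<close> finitely many operators suffice, so long words vanish.
  Since \<open>m\<close> depends on \<open>i\<close>, this does not yet give a zero layer, but it
  ends Nakayama's argument below.\<close>

lemma layer_subset_core:
  assumes "i \<ge> 0"
  obtains m where "layer m \<subseteq> core i"
proof -
  obtain E where E: "finite E" "\<And>e. e \<in> E \<Longrightarrow> integral_fls e"
    "\<And>f. integral_fls f \<Longrightarrow> \<exists>e\<in>E. \<forall>x\<in>lattice 0. \<psi> f x - \<psi> e x \<in> lattice i"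
    by (rule finite_action_modulo[OF assms]) blast
  have E_ops: "delta ` E \<subseteq> ops" using E(2) by (auto simp: ops_def)
  have "aug ops (lattice 0) \<subseteq> near (aug (delta ` E) (lattice 0)) (core i)"
  proof (rule aug_least)
    show "add_subgroup (near (aug (delta ` E) (lattice 0)) (core i))"
      by (intro add_subgroup_near add_subgroup_aug add_subgroup_core)
    fix y and x :: "'n \<Rightarrow> 'a fls" assume "y \<in> ops" and x: "x \<in> lattice 0"
    then obtain f where f: "integral_fls f" "y = delta f" by (auto simp: ops_def)
    obtain e where e: "e \<in> E" "\<And>x. x \<in> lattice 0 \<Longrightarrow> \<psi> f x - \<psi> e x \<in> lattice i"
      using E(3)[OF f(1)] by blast
    \<comment> \<open>Commuting \<open>\<psi> h\<close> inward evaluates the difference of the two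
      operators at \<open>\<psi> h x\<close>, which is still in \<open>lattice 0\<close>.\<close>
    have "\<psi> f x - \<psi> e x \<in> core i"
      unfolding core_def
    proof (intro CollectI conjI allI impI)
      show "\<psi> f x - \<psi> e x \<in> lattice 0"
        using add_subgroupD(2)[OF add_subgroup_lattice] preserve x f(1) E(2)[OF e(1)] by blast
      fix h :: "'a fls" assume "integral_fls h"
      then show "\<psi> h (\<psi> f x - \<psi> e x) \<in> lattice i"
        using e(2)[OF preserve[OF _ x], of h] by (simp add: action_diff commute_action[of h])
    qed
    moreover have "y x - delta e x = \<psi> f x - \<psi> e x" by (simp add: f(2) delta_def)
    ultimately show "y x \<in> near (aug (delta ` E) (lattice 0)) (core i)"
      unfolding near_def using augI[of "delta e" "delta ` E" x "lattice 0"] e(1) x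
      by (intro CollectI bexI[of _ "delta e x"]) auto
  qed
  from aug_funpow_subset_of_finite[OF add_subgroup_lattice invariant_lattice add_subgroup_core
      invariant_core finite_imageI[OF E(1)] E_ops this lessI]
  show ?thesis by (rule that)
qed

lemma Inter_core:
  assumes "\<And>i. i \<ge> 0 \<Longrightarrow> x \<in> core i"
  shows "x = 0"
proof -
  have "fls_nth (x l) k = 0" for l k
  proof -
    have "x \<in> lattice (max 0 (k + 1))" using assms core_subset by (meson max.cobounded1 subsetD)
    then show ?thesis by (simp add: lattice_def)
  qed
  then show ?thesis by (simp add: fun_eq_iff fls_eq_iff)
qed

text \<open>A single finite \<open>F\<close> serves all \<open>i\<close>, so a fixed number of
  further applications reaches every \<open>core i\<close>, and the cores meet only in 0.\<close>

lemma layer_eventually_zero: "\<exists>m. layer m \<subseteq> {0}"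
proof -
  \<comment> \<open>The chain starts at layer 1, so that each member is \<open>aug ops\<close> of a
    layer and finite supports exist.\<close>
  obtain k j where kj: "\<And>i. layer (Suc k) \<inter> lattice j \<subseteq> near (layer (Suc (Suc k))) (lattice i)"
    by (rule descending_chain_dense[of "\<lambda>m. layer (Suc m)"])
      (use add_subgroup_layer shift_layer layer_Suc_subset in blast)+
  have "layer (Suc k) \<subseteq> lattice 0" using layer_antimono[of 0 "Suc k"] by simp
  then obtain R where R: "finite R" "R \<subseteq> layer (Suc k)"
    "\<And>a. a \<in> layer (Suc k) \<Longrightarrow> \<exists>r\<in>R. a - r \<in> lattice j"
    by (rule finite_cosets_lattice[where j = j]) blast
  have "\<forall>r. \<exists>G. r \<in> R \<longrightarrow> finite G \<and> G \<subseteq> ops \<and> r \<in> aug G (layer k)"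
  proof
    fix r
    show "\<exists>G. r \<in> R \<longrightarrow> finite G \<and> G \<subseteq> ops \<and> r \<in> aug G (layer k)"
    proof (cases "r \<in> R")
      case True
      then have "r \<in> aug ops (layer k)" using R(2) by auto
      then show ?thesis by (rule aug_finite_support) blast
    qed simp
  qed
  from choice[OF this] obtain G where G: "\<And>r. r \<in> R \<Longrightarrow> finite (G r) \<and> G r \<subseteq> ops \<and> r \<in> aug (G r) (layer k)"
    by blast
  \<comment> \<open>The operators needed to write the representatives \<open>R\<close>, chosen
    independently of \<open>i\<close>.\<close>
  define F where "F = \<Union> (G ` R)"
  have F: "finite F" "F \<subseteq> ops" using R(1) G by (auto simp: F_def)
  have R_aug: "r \<in> aug F (layer k)" if "r \<in> R" for r
    using G[OF that] aug_mono[of "G r" F "layer k" "layer k"] that by (auto simp: F_def)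
  have in_core: "(aug ops ^^ Suc (CARD('a) * card F)) (layer k) \<subseteq> core i" if i: "i \<ge> 0" for i
  proof (rule aug_funpow_subset_of_finite[OF add_subgroup_layer invariant_layer add_subgroup_core
        invariant_core F _ lessI])
    obtain m where m: "layer m \<subseteq> core i" by (rule layer_subset_core[OF i])
    obtain l where l: "lattice l \<subseteq> core i" by (rule lattice_subset_core[OF i])
    show "aug ops (layer k) \<subseteq> near (aug F (layer k)) (core i)"
    proof (rule aug_subset_near_of_second_layer[OF invariant_layer add_subgroup_core invariant_core F(2)])
      have "(aug ops ^^ m) (aug ops (layer k)) = layer (m + Suc k)" by (simp add: funpow_add funpow_swap1)
      then show "(aug ops ^^ m) (aug ops (layer k)) \<subseteq> core i"
        using m layer_antimono[of m "m + Suc k"] by auto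
      show "aug ops (layer k)
          \<subseteq> near (add_span (aug F (layer k) \<union> aug ops (aug ops (layer k)))) (core i)"
      proof
        fix a assume "a \<in> aug ops (layer k)"
        then have a: "a \<in> layer (Suc k)" by simp
        \<comment> \<open>The representative \<open>r\<close> lies in
          \<open>aug F (layer k)\<close>. By \<open>kj\<close> the rest \<open>a - r\<close> is
          approximated by \<open>b\<close> from the second layer, up to \<open>lattice l\<close>,
          which lies in \<open>core i\<close>.\<close>
        then obtain r where r: "r \<in> R" "a - r \<in> lattice j" using R(3) by blast
        then have "a - r \<in> layer (Suc k) \<inter> lattice j"
          using a R(2) add_subgroupD(2)[OF add_subgroup_layer] by blast
        then obtain b where b: "b \<in> layer (Suc (Suc k))" "a - r - b \<in> lattice l"
          using kj[of l] by (auto simp: near_def)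
        have "r + b \<in> add_span (aug F (layer k) \<union> aug ops (aug ops (layer k)))"
          using R_aug[OF r(1)] b(1)
          by (intro add_subgroupD(4)[OF add_subgroup_add_span] add_span.base) auto
        moreover have "a - (r + b) \<in> core i" using b(2) l by (auto simp: diff_diff_eq)
        ultimately show "a \<in> near (add_span (aug F (layer k) \<union> aug ops (aug ops (layer k)))) (core i)"
          by (auto simp: near_def)
      qed
    qed
  qed
  have "layer (Suc (CARD('a) * card F) + k) \<subseteq> {0}"
    unfolding funpow_add comp_def using in_core Inter_core by blast
  then show ?thesis by blast
qed

lemma equivariant_funpow: "\<psi> (fls_X ^ k * f) ((shift ^^ k) v) = (shift ^^ k) (\<psi> f v)"
  by (induction k) (simp_all add: mult.assoc equivariant)

lemma fixed_vector: "\<exists>\<xi>. \<xi> \<noteq> 0 \<and> (\<forall>f. \<psi> f \<xi> = \<xi>)"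
proof -
  define m where "m = (LEAST m. layer m \<subseteq> {0})"
  have m: "layer m \<subseteq> {0}" unfolding m_def using layer_eventually_zero by (rule LeastI_ex)
  \<comment> \<open>The constant vector 1 shows that layer 0 is nonzero, so \<open>m\<close> has a
    predecessor.\<close>
  have "(\<lambda>_. 1) \<in> (lattice 0 :: ('n \<Rightarrow> 'a fls) set)" by (auto simp: lattice_def)
  moreover have "(\<lambda>_. 1) \<noteq> (0 :: 'n \<Rightarrow> 'a fls)" by (simp add: fun_eq_iff)
  ultimately have "m \<noteq> 0" using m by (cases m) auto
  then obtain q where q: "m = Suc q" by (cases m) auto
  have "\<not> layer q \<subseteq> {0}" using not_less_Least[of q "\<lambda>m. layer m \<subseteq> {0}"] q unfolding m_def by simp
  then obtain \<xi> where \<xi>: "\<xi> \<in> layer q" "\<xi> \<noteq> 0" by blast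
  have fixed: "\<psi> f v = v" if "integral_fls f" "v \<in> layer q" for f v
  proof -
    have "delta f v \<in> layer m" unfolding q using augI[of "delta f" ops v] that by (auto simp: ops_def)
    then show ?thesis using m by (auto simp: delta_def)
  qed
  have "\<psi> f \<xi> = \<xi>" for f
  proof -
    \<comment> \<open>Multiplication by \<open>t^k\<close> clears the pole of \<open>f\<close>;
      injectivity of \<open>shift\<close> later undoes it.\<close>
    define k where "k = nat (- fls_subdegree f)"
    have "integral_fls (fls_X ^ k * f)"
      by (auto simp: integral_fls_def fls_X_power_times_conv_shift k_def)
    moreover have "(shift ^^ k) \<xi> \<in> layer q" by (induction k) (use \<xi> shift_layer in auto)
    ultimately have "(shift ^^ k) (\<psi> f \<xi>) = (shift ^^ k) \<xi>"
      using fixed equivariant_funpow by metis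
    moreover have "inj (shift :: ('n \<Rightarrow> 'a fls) \<Rightarrow> _)"
      by (rule injI) (simp add: shift_def fun_eq_iff)
    ultimately show ?thesis by (metis inj_fn injD)
  qed
  then show ?thesis using \<xi> by blast
qed

end

section \<open>Reduction to the rescaled action\<close>

theorem theoremB:
  fixes \<phi> :: "'a::{field,finite} fls \<Rightarrow> (('n::finite \<Rightarrow> 'a fls) \<Rightarrow> ('n \<Rightarrow> 'a fls))"
    and \<tau> :: "('n \<Rightarrow> 'a fls) \<Rightarrow> ('n \<Rightarrow> 'a fls)"
  assumes "prime CARD('a)"
    and "\<forall>f. \<phi> f \<in> top_group_aut"
    and "\<forall>f g. \<phi> (f + g) = \<phi> f \<circ> \<phi> g"
    and "braconnier_continuous \<phi>"
    and "\<tau> = (\<lambda>v i. fls_X * v i)"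
    and "\<forall>f. \<phi> (fls_X * f) = \<tau> \<circ> \<phi> f \<circ> inv \<tau>"
  shows "\<exists>\<xi>. \<xi> \<noteq> 0 \<and> (\<forall>f. \<phi> f \<xi> = \<xi>)"
proof -
  have add: "\<forall>u v. \<phi> f (u + v) = \<phi> f u + \<phi> f v" and bij: "bij (\<phi> f)"
    and cont: "continuous_on UNIV (\<phi> f)" for f
    using assms(2) by (auto simp: top_group_aut_def)
  \<comment> \<open>\<open>\<phi> 0\<close> is idempotent under composition and injective, hence the
    identity.\<close>
  have zero: "\<phi> 0 v = v" for v
    using fun_cong[OF assms(3)[rule_format, of 0 0], of v] bij_is_inj[OF bij[of 0]]
    by (simp add: inj_eq)
  then have id: "\<phi> 0 = id" by (simp add: fun_eq_iff)
  have \<tau>: "\<tau> = shift" using assms(5) by (simp add: shift_def fun_eq_iff)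
  have "inj (shift :: ('n \<Rightarrow> 'a fls) \<Rightarrow> _)" by (rule injI) (simp add: shift_def fun_eq_iff)
  then have equivariant: "\<phi> (fls_X * f) (shift v) = shift (\<phi> f v)" for f v
    using assms(6) \<tau> by simp
  \<comment> \<open>For \<open>f\<close> in \<open>t^N F_p[[t]]\<close>, points of
    \<open>lattice 0\<close> move by elements of \<open>lattice 0\<close>, so the lattice is
    preserved.\<close>
  obtain N where N: "\<And>f x. \<forall>k<int N. fls_nth f k = 0 \<Longrightarrow> x \<in> lattice 0 \<Longrightarrow> \<phi> f x - x \<in> lattice 0"
    by (rule braconnier_continuous_small[OF assms(4) id order_refl]) blast
  have nth: "fls_nth (fls_X ^ N * f) k = fls_nth f (k - int N)" for f :: "'a fls" and k
    by (simp add: fls_X_power_times_conv_shift)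
  interpret contractive_action "\<lambda>f. \<phi> (fls_X ^ N * f)"
  proof
    show "prime CARD('a)" by (rule assms(1))
    fix f g :: "'a fls" and v :: "'n \<Rightarrow> 'a fls" and i :: int
    show "\<forall>u v. \<phi> (fls_X ^ N * f) (u + v) = \<phi> (fls_X ^ N * f) u + \<phi> (fls_X ^ N * f) v"
      by (rule add)
    show "\<phi> (fls_X ^ N * (f + g)) v = \<phi> (fls_X ^ N * f) (\<phi> (fls_X ^ N * g) v)"
      using assms(3) by (simp add: ring_distribs)
    show "\<phi> (fls_X ^ N * 0) v = v" by (simp add: zero)
    show "\<exists>n. \<forall>x\<in>lattice (int n). \<phi> (fls_X ^ N * f) x \<in> lattice i"
      by (rule continuous_additive_lattice[OF cont additive_0[OF add]]) blast
    show "\<phi> (fls_X ^ N * (fls_X * f)) (shift v) = shift (\<phi> (fls_X ^ N * f) v)"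
      using equivariant[of "fls_X ^ N * f" v] by (simp add: mult.left_commute)
    show "\<exists>n. \<forall>f. \<forall>x\<in>lattice 0. (\<forall>k<int n. fls_nth f k = 0) \<longrightarrow> \<phi> (fls_X ^ N * f) x - x \<in> lattice i"
      if i: "i \<ge> 0"
    proof -
      obtain n where n: "\<And>f x. \<forall>k<int n. fls_nth f k = 0 \<Longrightarrow> x \<in> lattice 0 \<Longrightarrow> \<phi> f x - x \<in> lattice i"
        by (rule braconnier_continuous_small[OF assms(4) id i]) blast
      then show ?thesis by (intro exI[of _ n] allI ballI impI n) (auto simp: nth)
    qed
    show "\<phi> (fls_X ^ N * f) v \<in> lattice 0" if "integral_fls f" "v \<in> lattice 0"
    proof -
      have "\<phi> (fls_X ^ N * f) v - v \<in> lattice 0"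
        by (rule N) (use that in \<open>auto simp: nth integral_fls_def\<close>)
      from add_subgroupD(4)[OF add_subgroup_lattice this that(2)] show ?thesis by simp
    qed
  qed
  obtain \<xi> where \<xi>: "\<xi> \<noteq> 0" "\<And>f. \<phi> (fls_X ^ N * f) \<xi> = \<xi>" using fixed_vector by blast
  \<comment> \<open>Each \<open>f\<close> is \<open>t^N\<close> times another series, so the
    rescaled action reaches all of \<open>\<phi>\<close>.\<close>
  have "\<phi> f \<xi> = \<xi>" for f
    using \<xi>(2)[of "inverse (fls_X ^ N) * f"] by (simp add: mult.assoc[symmetric])
  then show ?thesis using \<xi>(1) by blast
qed

end
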